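(* Let $l:\mathbb{C}\to(0,+\infty)$ be continuous with $l\in Q\cap K$, and let $f:\mathbb{C}\to\mathbb{C}$ be an entire function of bounded $l$-index. Then $$\ln\max\{|f(z)|:|z|=r\}=O\left(\min_{\theta\in[0,2\pi]}\int_0^r l(te^{i\theta})\,dt\right)\quad\text{as }r\to\infty.$$
   Context: Bounded $l$-index: an entire function $f$ is of bounded $l$-index if there exists an integer $m\ge0$ such that for all integers $p\ge0$ and all $z\in\mathbb{C}$, $\frac{|f^{(p)}(z)|}{p!\,l^p(z)}\le\max\left\{\frac{|f^{(s)}(z)|}{s!\,l^s(z)}:0\le s\le m\right\}$. Class $Q=Q^1$: the class of positive continuous functions $l$ on $\mathbb{C}$ such that for every $r\ge0$, $0<\lambda_1(r)\le\lambda_2(r)<+\infty$, where $$\lambda_1(r)=\inf_{z^0\in\mathbb{C}}\inf\left\{\frac{l(z)}{l(z^0)}:|z-z^0|\le\frac{r}{l(z^0)}\right\},\qquad \lambda_2(r)=\sup_{z^0\in\mathbb{C}}\sup\left\{\frac{l(z)}{l(z^0)}:|z-z^0|\le\frac{r}{l(z^0)}\right\}.$$ Class $K=K^1$: the class of positive continuous functions $l$ on $\mathbb{C}$ for which there exists $c>0$ such that for every $r\ge0$, $\max_{\theta_1,\theta_2\in[0,2\pi]}\frac{l(re^{i\theta_2})}{l(re^{i\theta_1})}\le c$. *)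

theory Defs
  imports "HOL-Complex_Analysis.Complex_Analysis" "HOL-Library.Landau_Symbols"
begin

definition bounded_l_index :: "(complex \<Rightarrow> real) \<Rightarrow> (complex \<Rightarrow> complex) \<Rightarrow> bool" where
  "bounded_l_index l f \<longleftrightarrow>
     (\<exists>m::nat. \<forall>(p::nat) (z::complex).
        norm ((deriv ^^ p) f z) / (fact p * l z ^ p)
          \<le> Max ((\<lambda>s. norm ((deriv ^^ s) f z) / (fact s * l z ^ s)) ` {0..m}))"

text \<open>The infimum and supremum are taken in the extended reals, because real-valued
  \<open>Inf\<close> and \<open>Sup\<close> are unspecified on unbounded sets and finiteness of \<open>lambda2\<close> is a
  genuine condition.\<close>

definition lambda1 :: "(complex \<Rightarrow> real) \<Rightarrow> real \<Rightarrow> ereal" where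
  "lambda1 l r = (INF z0. INF z\<in>{z. norm (z - z0) \<le> r / l z0}. ereal (l z / l z0))"

definition lambda2 :: "(complex \<Rightarrow> real) \<Rightarrow> real \<Rightarrow> ereal" where
  "lambda2 l r = (SUP z0. SUP z\<in>{z. norm (z - z0) \<le> r / l z0}. ereal (l z / l z0))"

definition class_Q :: "(complex \<Rightarrow> real) set" where
  "class_Q = {l. continuous_on UNIV l \<and> (\<forall>z. l z > 0) \<and>
     (\<forall>r\<ge>0. 0 < lambda1 l r \<and> lambda1 l r \<le> lambda2 l r \<and> lambda2 l r < \<infinity>)}"

definition class_K :: "(complex \<Rightarrow> real) set" where
  "class_K = {l. continuous_on UNIV l \<and> (\<forall>z. l z > 0) \<and>
     (\<exists>c>0. \<forall>r\<ge>0.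
        (SUP \<theta>1\<in>{0..2*pi}. SUP \<theta>2\<in>{0..2*pi}.
           ereal (l (of_real r * cis \<theta>2) / l (of_real r * cis \<theta>1))) \<le> ereal c)}"

text \<open>\<open>Max\<close> and \<open>Min\<close> are only meaningful on finite sets. In the next two definitions, for
  continuous \<open>f\<close> and \<open>l\<close> and for \<open>r \<ge> 0\<close>, the supremum and infimum are attained by compactness.\<close>

definition max_modulus :: "(complex \<Rightarrow> complex) \<Rightarrow> real \<Rightarrow> real" where
  "max_modulus f r = (SUP z\<in>{z. norm z = r}. norm (f z))"

definition min_ray_integral :: "(complex \<Rightarrow> real) \<Rightarrow> real \<Rightarrow> real" where
  "min_ray_integral l r =
     (INF \<theta>\<in>{0..2*pi}. integral {0..r} (\<lambda>t. l (of_real t * cis \<theta>)))"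

end

theory Submission imports Defs begin

text \<open>
  Let \<open>g z = max {|f\<^sup>(\<^sup>s\<^sup>)(z)| / (s! l(z)\<^sup>s) : s \<le> m}\<close>. Bounded index makes the Taylor series of \<open>f\<close> at
  \<open>z\<close> geometrically dominated, so \<open>|f| \<le> 2 g z\<close> on the disc of radius \<open>1 / (2 l z)\<close>; Cauchy's
  inequality and the class \<open>Q\<close> then give \<open>g w \<le> A g z\<close> for \<open>|w - z| \<le> 1 / (4 l z)\<close>. Along a ray,
  crossing such a disc costs at least a fixed amount \<open>\<delta>\<close> of \<open>\<integral> l\<close>, again by the class \<open>Q\<close>. Hence
  \<open>g\<close> grows by at most \<open>A\<close> to the power \<open>1 + \<integral> l / \<delta>\<close>, and the class \<open>K\<close> makes the integrals over
  different rays comparable.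
\<close>

definition index_max :: "(complex \<Rightarrow> real) \<Rightarrow> (complex \<Rightarrow> complex) \<Rightarrow> nat \<Rightarrow> complex \<Rightarrow> real" where
  "index_max l f m z = Max ((\<lambda>s. norm ((deriv ^^ s) f z) / (fact s * l z ^ s)) ` {0..m})"

section \<open>Uniform constants from the classes \<open>Q\<close> and \<open>K\<close>\<close>

lemma class_Q_lower:
  assumes "l \<in> class_Q" "r \<ge> 0"
  obtains q where "0 < q" "q \<le> 1" "\<And>z z0. norm (z - z0) \<le> r / l z0 \<Longrightarrow> q * l z0 \<le> l z"
proof -
  have pos: "\<And>z. l z > 0" and L: "0 < lambda1 l r"
    using assms by (auto simp: class_Q_def)
  \<comment> \<open>The infimum lives in the extended reals; density supplies a real constant
    strictly between 0 and it.\<close>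
  obtain q where q: "0 < ereal q" "ereal q < lambda1 l r"
    using ereal_dense2[OF L] by auto
  have lower: "q * l z0 \<le> l z" if "norm (z - z0) \<le> r / l z0" for z z0
  proof -
    have "lambda1 l r \<le> ereal (l z / l z0)"
      unfolding lambda1_def using that by (intro INF_lower2[of z0] INF_lower) auto
    with q have "ereal q \<le> ereal (l z / l z0)" by order
    then show ?thesis using pos[of z0] by (simp add: field_simps)
  qed
  have "q \<le> 1" using lower[of 0 0] pos[of 0] assms(2) by simp
  with that q lower show thesis by simp
qed

lemma class_K_upper:
  assumes "l \<in> class_K"
  obtains c where "0 < c"
    "\<And>r a b. \<lbrakk>0 \<le> r; a \<in> {0..2*pi}; b \<in> {0..2*pi}\<rbrakk>
       \<Longrightarrow> l (of_real r * cis b) \<le> c * l (of_real r * cis a)"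
proof -
  obtain c where c: "c > 0" and
    sup: "\<And>r. r \<ge> 0 \<Longrightarrow> (SUP \<theta>1\<in>{0..2*pi}. SUP \<theta>2\<in>{0..2*pi}.
           ereal (l (of_real r * cis \<theta>2) / l (of_real r * cis \<theta>1))) \<le> ereal c"
    and pos: "\<And>z. l z > 0"
    using assms by (auto simp: class_K_def)
  show thesis
  proof (rule that[OF c])
    fix r a b :: real assume *: "0 \<le> r" "a \<in> {0..2*pi}" "b \<in> {0..2*pi}"
    have "ereal (l (of_real r * cis b) / l (of_real r * cis a)) \<le> ereal c"
      using sup[OF *(1)] * by (auto simp: SUP_le_iff)
    then show "l (of_real r * cis b) \<le> c * l (of_real r * cis a)"
      using pos[of "of_real r * cis a"] by (simp add: field_simps)
  qed
qed

section \<open>Variation of the local maximum over small discs\<close>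

lemma index_max_ge:
  assumes "s \<le> m"
  shows "norm ((deriv ^^ s) f z) / (fact s * l z ^ s) \<le> index_max l f m z"
  unfolding index_max_def using assms by (intro Max_ge) auto

lemma norm_le_index_max: "norm (f z) \<le> index_max l f m z"
  using index_max_ge[of 0 m f z l] by simp

lemma index_max_nonneg: "0 \<le> index_max l f m z"
  using norm_le_index_max[of f z l m] norm_ge_zero[of "f z"] by linarith

lemma index_max_leI:
  assumes "\<And>s. s \<le> m \<Longrightarrow> norm ((deriv ^^ s) f z) / (fact s * l z ^ s) \<le> B"
  shows "index_max l f m z \<le> B"
  unfolding index_max_def using assms by (subst Max_le_iff) auto

context
  fixes l :: "complex \<Rightarrow> real" and f :: "complex \<Rightarrow> complex" and m :: nat
  assumes pos: "\<And>z. l z > 0"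
    and hol: "f holomorphic_on UNIV"
    and index: "\<And>p z. norm ((deriv ^^ p) f z) / (fact p * l z ^ p) \<le> index_max l f m z"
begin

lemma norm_le_index_max_nearby:
  assumes "norm (w - z) \<le> 1 / (2 * l z)"
  shows "norm (f w) \<le> 2 * index_max l f m z"
proof -
  let ?g = "index_max l f m z"
  let ?a = "\<lambda>n. (deriv ^^ n) f z / fact n * (w - z) ^ n"
  have sums: "?a sums f w"
    by (rule holomorphic_power_series[where r = "norm (w - z) + 1"])
       (use hol in \<open>auto intro: holomorphic_on_subset simp: dist_norm norm_minus_commute\<close>)
  have bound: "norm (?a n) \<le> ?g * (1/2) ^ n" for n
  proof -
    \<comment> \<open>Inserting \<open>l z ^ n\<close> separates the normalised coefficient, which
      bounded index controls for every \<open>n\<close>, from a factor at most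
      \<open>(1/2) ^ n\<close>.\<close>
    have "norm (?a n) = norm ((deriv ^^ n) f z) / (fact n * l z ^ n) * (l z * norm (w - z)) ^ n"
      using pos[of z] by (simp add: norm_mult norm_divide norm_power power_mult_distrib)
    also have "\<dots> \<le> ?g * (1/2) ^ n"
      using index[of n z] assms pos[of z]
      by (intro mult_mono power_mono) (auto simp: field_simps index_max_nonneg)
    finally show ?thesis .
  qed
  have geo: "(\<lambda>n. ?g * (1/2::real) ^ n) sums (?g * 2)"
    using sums_mult[OF geometric_sums[of "1/2::real"], of ?g] by simp
  have "norm (suminf ?a) \<le> (\<Sum>n. ?g * (1/2) ^ n)"
    by (rule norm_suminf_le[OF bound sums_summable[OF geo]])
  then show ?thesis using sums_unique[OF sums] sums_unique[OF geo] by simp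
qed

lemma index_max_nearby:
  assumes q: "0 < q" "q \<le> 1" and lz: "q * l z \<le> l w"
    and w: "norm (w - z) \<le> 1 / (4 * l z)"
  shows "index_max l f m w \<le> 2 * (4 / q) ^ m * index_max l f m z"
proof (rule index_max_leI)
  fix s assume s: "s \<le> m"
  let ?g = "index_max l f m z" and ?r = "1 / (4 * l z)"
  \<comment> \<open>The circle of radius \<open>1 / (4 * l z)\<close> about \<open>w\<close> stays
    within \<open>1 / (2 * l z)\<close> of \<open>z\<close>, where \<open>f\<close> is already
    bounded.\<close>
  have "norm ((deriv ^^ s) f w) \<le> fact s * (2 * ?g) / ?r ^ s"
  proof (rule Cauchy_inequality)
    show "f holomorphic_on ball w ?r" "continuous_on (cball w ?r) f"
      using hol holomorphic_on_imp_continuous_on holomorphic_on_subset by blast+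
    show "0 < ?r" using pos[of z] by simp
    fix x assume "norm (w - x) = ?r"
    then have "norm (x - z) \<le> ?r + ?r"
      using w norm_triangle_ineq[of "x - w" "w - z"] by (simp add: norm_minus_commute)
    then show "norm (f x) \<le> 2 * ?g" by (intro norm_le_index_max_nearby) simp
  qed
  then have "norm ((deriv ^^ s) f w) / (fact s * l w ^ s) \<le> fact s * (2 * ?g) / ?r ^ s / (fact s * l w ^ s)"
    using pos[of w] by (intro divide_right_mono) auto
  also have "\<dots> = 2 * ?g * (4 * l z / l w) ^ s"
    by (simp add: power_divide field_simps)
  also have "\<dots> \<le> 2 * ?g * (4 / q) ^ s"
    using pos[of z] pos[of w] q lz
    by (intro mult_left_mono power_mono) (auto simp: field_simps index_max_nonneg)
  \<comment> \<open>As \<open>q \<le> 1\<close>, the base \<open>4 / q\<close> is at least 1, so the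
    power \<open>m\<close> serves all \<open>s \<le> m\<close>.\<close>
  also have "\<dots> \<le> 2 * ?g * (4 / q) ^ m"
    using q s by (intro mult_left_mono power_increasing) (auto simp: field_simps index_max_nonneg)
  finally show "norm ((deriv ^^ s) f w) / (fact s * l w ^ s) \<le> 2 * (4 / q) ^ m * ?g"
    by (simp add: mult_ac)
qed

end

section \<open>Growth along a ray\<close>

text \<open>A discrete Gronwall estimate. The induction splits off the last piece of the integral by the
  intermediate value theorem, so no chain of step points has to be constructed.\<close>

lemma growth_along_integral:
  fixes h G :: "real \<Rightarrow> real"
  assumes cont: "continuous_on UNIV h" and pos: "\<And>t. h t > 0"
    and q: "q > 0" and \<kappa>: "\<kappa> > 0" and A: "A \<ge> 0"
    and h: "\<And>s t. \<lbrakk>0 \<le> s; s \<le> t; t - s \<le> \<kappa> / h s\<rbrakk> \<Longrightarrow> q * h s \<le> h t"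
    and G: "\<And>s t. \<lbrakk>0 \<le> s; s \<le> t; t - s \<le> \<kappa> / h s\<rbrakk> \<Longrightarrow> G t \<le> A * G s"
    and "0 \<le> t" "integral {0..t} h \<le> real (Suc n) * (q * \<kappa> / 2)"
  shows "G t \<le> A ^ Suc n * G 0"
proof -
  let ?\<delta> = "q * \<kappa> / 2"
  have int: "h integrable_on {a..b}" for a b
    by (intro integrable_continuous_interval continuous_on_subset[OF cont]) simp
  \<comment> \<open>A longer piece would contain an initial segment of length
    \<open>\<kappa> / h s\<close> on which \<open>h\<close> is at least \<open>q * h s\<close>,
    hence of integral at least \<open>q * \<kappa>\<close>. The halving in \<open>?\<delta>\<close>
    makes this a strict contradiction.\<close>
  have step: "t - s \<le> \<kappa> / h s" if st: "0 \<le> s" "s \<le> t" "integral {s..t} h \<le> ?\<delta>" for s t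
  proof (rule ccontr)
    assume far: "\<not> t - s \<le> \<kappa> / h s"
    let ?u = "s + \<kappa> / h s"
    have u: "s \<le> ?u" "?u \<le> t" using far pos[of s] \<kappa> by auto
    have "q * \<kappa> = integral {s..?u} (\<lambda>_. q * h s)"
      using u(1) pos[of s] by simp
    also have "\<dots> \<le> integral {s..?u} h"
      using st by (intro integral_le int h) auto
    also have "\<dots> \<le> integral {s..t} h"
      using u pos by (intro integral_subset_le int) (auto intro: less_imp_le)
    finally show False using st q \<kappa> mult_pos_pos[OF q \<kappa>] by linarith
  qed
  show ?thesis using assms(8,9)
  proof (induction n arbitrary: t)
    case 0
    then show ?case using step[of 0 t] G[of 0 t] by simp
  next
    case (Suc n)
    show ?case
    proof (cases "integral {0..t} h \<le> ?\<delta>")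
      case True
      with Suc.prems q \<kappa> have "G t \<le> A * G 0"
        using step[of 0 t] G[of 0 t] by simp
      \<comment> \<open>One step gives only the factor \<open>A\<close>, and
        \<open>A \<ge> 1\<close> is not assumed, so the bound cannot simply be enlarged. The
        induction hypothesis at time 0 supplies the remaining powers.\<close>
      have "integral {0..0} h \<le> real (Suc n) * ?\<delta>" using q \<kappa> by simp
      from Suc.IH[OF _ this] have "G 0 \<le> A ^ Suc n * G 0" by simp
      then have "A * G 0 \<le> A * (A ^ Suc n * G 0)" using A by (rule mult_left_mono)
      with \<open>G t \<le> A * G 0\<close> show ?thesis by simp
    next
      case False
      \<comment> \<open>The cut point \<open>s\<close> is chosen so that the integral over the last
        piece is exactly \<open>?\<delta>\<close>.\<close>
      have "continuous_on {0..t} (\<lambda>x. integral {0..x} h)"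
        by (rule indefinite_integral_continuous_1[OF int])
      then obtain s where s: "0 \<le> s" "s \<le> t" "integral {0..s} h = integral {0..t} h - ?\<delta>"
        using IVT'[of "\<lambda>x. integral {0..x} h" 0 "integral {0..t} h - ?\<delta>" t] False Suc.prems q \<kappa>
        by auto
      have "integral {0..s} h + integral {s..t} h = integral {0..t} h"
        by (rule Henstock_Kurzweil_Integration.integral_combine[OF s(1,2) int])
      then have last: "t - s \<le> \<kappa> / h s" using s by (intro step) auto
      have "integral {0..s} h \<le> real (Suc n) * ?\<delta>"
        using s(3) Suc.prems(2) by (simp add: algebra_simps)
      from Suc.IH[OF s(1) this] have "A * G s \<le> A * (A ^ Suc n * G 0)"
        using A by (rule mult_left_mono)
      with G[OF s(1,2) last] show ?thesis by simp
    qed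
  qed
qed

section \<open>Bounds for the maximum modulus\<close>

text \<open>Compactness of the circle bounds the values of a continuous function there, so the real
  supremum is a genuine one.\<close>

lemma norm_le_max_modulus:
  assumes "continuous_on UNIV f" "norm z = r"
  shows "norm (f z) \<le> max_modulus f r"
proof -
  have "compact ((\<lambda>z. norm (f z)) ` sphere 0 r)"
    by (intro compact_continuous_image continuous_intros continuous_on_subset[OF assms(1)]) auto
  moreover have "sphere 0 r = {z. norm z = r}" by (auto simp: sphere_def)
  ultimately have "bdd_above ((\<lambda>z. norm (f z)) ` {z. norm z = r})"
    using bounded_imp_bdd_above compact_imp_bounded by metis
  then show ?thesis unfolding max_modulus_def using assms(2) by (intro cSUP_upper) auto
qed

lemma max_modulus_leI:
  assumes "0 \<le> r" "\<And>z. norm z = r \<Longrightarrow> norm (f z) \<le> B"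
  shows "max_modulus f r \<le> B"
  unfolding max_modulus_def
proof (rule cSUP_least)
  show "{z::complex. norm z = r} \<noteq> {}" using assms(1) by (auto intro!: exI[of _ "of_real r"])
qed (use assms in auto)

lemma deriv_le_max_modulus:
  assumes "f holomorphic_on UNIV" "1 \<le> r"
  shows "norm ((deriv ^^ n) f 0) / fact n \<le> max_modulus f r"
proof -
  have cont: "continuous_on UNIV f" using assms(1) by (rule holomorphic_on_imp_continuous_on)
  have "norm ((deriv ^^ n) f 0) \<le> fact n * max_modulus f r / r ^ n"
    using assms
    by (intro Cauchy_inequality norm_le_max_modulus[OF cont])
       (auto intro: holomorphic_on_subset continuous_on_subset[OF cont])
  also have "\<dots> \<le> fact n * max_modulus f r / 1"
  proof (rule divide_left_mono)
    have "0 \<le> max_modulus f r"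
      using norm_le_max_modulus[OF cont, of "of_real r" r] assms(2)
      by (simp add: order_trans[OF norm_ge_zero])
    then show "0 \<le> fact n * max_modulus f r" by simp
  qed (use assms(2) in \<open>auto intro: one_le_power\<close>)
  finally show ?thesis by (simp add: field_simps)
qed

section \<open>Comparison of ray integrals\<close>

lemma integrable_on_ray:
  assumes "continuous_on UNIV l"
  shows "(\<lambda>t. l (of_real t * cis \<theta>) :: real) integrable_on {a..b}"
  by (intro integrable_continuous_interval continuous_on_compose2[OF assms] continuous_intros) auto

text \<open>The integrands on two rays are comparable at each radius with the same constant
  \<open>c\<close>, so the integrals are too, and the infimum over the second ray may be
  taken.\<close>

lemma ray_integral_le_min_ray_integral:
  assumes cont: "continuous_on UNIV l"
    and c: "0 < c" "\<And>r a b. \<lbrakk>0 \<le> r; a \<in> {0..2*pi}; b \<in> {0..2*pi}\<rbrakk>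
       \<Longrightarrow> l (of_real r * cis b) \<le> c * l (of_real r * cis a)"
    and "\<theta> \<in> {0..2*pi}"
  shows "integral {0..r} (\<lambda>t. l (of_real t * cis \<theta>)) \<le> c * min_ray_integral l r"
proof -
  let ?I = "\<lambda>\<theta>. integral {0..r} (\<lambda>t. l (of_real t * cis \<theta>))"
  have "?I \<theta> / c \<le> min_ray_integral l r"
    unfolding min_ray_integral_def
  proof (rule cINF_greatest)
    fix \<theta>' :: real assume "\<theta>' \<in> {0..2*pi}"
    then have "?I \<theta> \<le> integral {0..r} (\<lambda>t. c * l (of_real t * cis \<theta>'))"
      using assms(4) c(2)
      by (intro integral_le integrable_on_ray[OF cont] integrable_on_mult_right) auto
    then show "?I \<theta> / c \<le> ?I \<theta>'" using c(1) by (simp add: field_simps)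
  qed auto
  then show ?thesis using c(1) by (simp add: field_simps)
qed

text \<open>Every ray integral with \<open>r \<ge> 1\<close> includes the unit segment, on which
  \<open>l\<close> is at least its positive minimum over the closed unit disc. This lets additive
  constants be absorbed into the final estimate.\<close>

lemma min_ray_integral_lower:
  assumes cont: "continuous_on UNIV l" and pos: "\<And>z. l z > 0"
  obtains b where "0 < b" "\<And>r. 1 \<le> r \<Longrightarrow> b \<le> min_ray_integral l r"
proof -
  have "continuous_on (cball 0 1) l" by (rule continuous_on_subset[OF cont]) simp
  from continuous_attains_inf[OF _ _ this]
  obtain x where x: "\<And>y. norm y \<le> 1 \<Longrightarrow> l x \<le> l y" by (force simp: dist_norm)
  have "l x \<le> min_ray_integral l r" if "1 \<le> r" for r
    unfolding min_ray_integral_def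
  proof (rule cINF_greatest)
    fix \<theta> :: real
    have "l x = integral {0..1::real} (\<lambda>_. l x)" by simp
    also have "\<dots> \<le> integral {0..1} (\<lambda>t. l (of_real t * cis \<theta>))"
      by (intro integral_le integrable_on_ray[OF cont] x) (auto simp: norm_mult)
    also have "\<dots> \<le> integral {0..r} (\<lambda>t. l (of_real t * cis \<theta>))"
      using that pos by (intro integral_subset_le integrable_on_ray[OF cont]) (auto intro: less_imp_le)
    finally show "l x \<le> integral {0..r} (\<lambda>t. l (of_real t * cis \<theta>))" .
  qed auto
  with that pos show thesis by blast
qed

section \<open>The exponential upper bound\<close>

lemma max_modulus_le_exp_min_ray_integral:
  assumes cont: "continuous_on UNIV l" and pos: "\<And>z. l z > 0"
    and "l \<in> class_Q" "l \<in> class_K"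
    and hol: "f holomorphic_on UNIV"
    and index: "\<And>p z. norm ((deriv ^^ p) f z) / (fact p * l z ^ p) \<le> index_max l f m z"
  obtains a where "0 < a"
    "\<And>r. 0 \<le> r \<Longrightarrow> max_modulus f r \<le> exp (a * (1 + min_ray_integral l r)) * index_max l f m 0"
proof -
  obtain q where q: "0 < q" "q \<le> 1" "\<And>z z0. norm (z - z0) \<le> (1/4) / l z0 \<Longrightarrow> q * l z0 \<le> l z"
    using class_Q_lower[OF assms(3), of "1/4"] by auto
  obtain c where c: "0 < c" "\<And>r a b. \<lbrakk>0 \<le> r; a \<in> {0..2*pi}; b \<in> {0..2*pi}\<rbrakk>
       \<Longrightarrow> l (of_real r * cis b) \<le> c * l (of_real r * cis a)"
    using class_K_upper[OF assms(4)] by metis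
  \<comment> \<open>\<open>A\<close> is the growth factor over one disc and \<open>\<delta>\<close>
    the guaranteed cost of crossing it, with \<open>\<kappa> = 1/4\<close>.\<close>
  define A where "A = 2 * (4 / q) ^ m"
  define \<delta> where "\<delta> = q * (1/4) / 2"
  have \<delta>: "\<delta> > 0" using q by (simp add: \<delta>_def)
  have "1 \<le> (4 / q) ^ m" using q by (intro one_le_power) (auto simp: field_simps)
  then have A: "A > 1" by (simp add: A_def)
  \<comment> \<open>Chosen so that \<open>ln A * (1 + c / \<delta> * I) \<le> a * (1 + I)\<close>
    for every \<open>I \<ge> 0\<close>.\<close>
  define a where "a = ln A * (1 + c / \<delta>)"
  have a: "a > 0" using A c \<delta> by (simp add: a_def add_pos_pos)
  show thesis
  proof (rule that[OF a])
    fix r :: real assume r: "0 \<le> r"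
    let ?I = "min_ray_integral l r"
    show "max_modulus f r \<le> exp (a * (1 + ?I)) * index_max l f m 0"
    proof (rule max_modulus_leI[OF r])
      fix z :: complex assume z: "norm z = r"
      define \<theta> where "\<theta> = Arg2pi z"
      have \<theta>: "\<theta> \<in> {0..2*pi}" using Arg2pi[of z] by (auto simp: \<theta>_def)
      have z_eq: "z = of_real r * cis \<theta>"
        using Arg2pi_eq[of z] z by (simp add: \<theta>_def cis_conv_exp)
      let ?h = "\<lambda>t. l (of_real t * cis \<theta>)"
      let ?G = "\<lambda>t::real. index_max l f m (of_real t * cis \<theta>)"
      define J where "J = integral {0..r} ?h"
      \<comment> \<open>The floor makes \<open>Suc n\<close> steps enough to cover \<open>J\<close>,
        while \<open>n \<le> J / \<delta>\<close> keeps the exponent linear in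
        \<open>J\<close>.\<close>
      define n where "n = nat \<lfloor>J / \<delta>\<rfloor>"
      have J0: "0 \<le> J" unfolding J_def using pos
        by (intro integral_nonneg integrable_on_ray[OF cont]) (auto intro: less_imp_le)
      have J: "J \<le> c * ?I"
        unfolding J_def by (rule ray_integral_le_min_ray_integral[OF cont c \<theta>])
      have I0: "0 \<le> ?I" using J J0 c(1) by (metis order_trans zero_le_mult_iff not_less)
      have n: "J \<le> real (Suc n) * \<delta>" "real n \<le> J / \<delta>"
      proof -
        have "J / \<delta> \<le> real (Suc n)" unfolding n_def by linarith
        then show "J \<le> real (Suc n) * \<delta>" using \<delta> by (simp add: field_simps)
        show "real n \<le> J / \<delta>" unfolding n_def using J0 \<delta> by (simp add: of_nat_floor)
      qed
      have near: "norm (of_real t * cis \<theta> - of_real s * cis \<theta>) \<le> (1/4) / ?h s"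
        if "s \<le> t" "t - s \<le> (1/4) / ?h s" for s t
      proof -
        have "of_real t * cis \<theta> - of_real s * cis \<theta> = of_real (t - s) * cis \<theta>"
          by (simp add: algebra_simps)
        then show ?thesis using that by (simp add: norm_mult del: of_real_diff)
      qed
      have "?G r \<le> A ^ Suc n * ?G 0"
      proof (rule growth_along_integral[where h = ?h and q = q and \<kappa> = "1/4"])
        show "continuous_on UNIV ?h"
          by (intro continuous_on_compose2[OF cont] continuous_intros) auto
        fix s t assume "s \<le> t" "t - s \<le> (1/4) / ?h s"
        note near = near[OF this]
        show "q * ?h s \<le> ?h t" by (rule q(3)[OF near])
        show "?G t \<le> A * ?G s"
          unfolding A_def
          by (rule index_max_nearby[OF pos hol index q(1,2) q(3)[OF near]]) (use near in auto)
      qed (use pos q A r n in \<open>auto simp: J_def \<delta>_def\<close>)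
      also have "A ^ Suc n = exp (ln A * (1 + real n))"
        using A by (simp add: exp_of_nat_mult[symmetric] ln_realpow[symmetric] mult.commute exp_add
            distrib_left)
      also have "\<dots> \<le> exp (a * (1 + ?I))"
      proof -
        have "1 + real n \<le> 1 + c / \<delta> * ?I" using n(2) J \<delta> by (simp add: field_simps)
        also have "\<dots> \<le> (1 + c / \<delta>) * (1 + ?I)"
          using c \<delta> I0 by (simp add: field_simps)
        finally show ?thesis using A by (simp add: a_def mult.assoc)
      qed
      finally have "?G r \<le> exp (a * (1 + ?I)) * ?G 0"
        by (simp add: mult_right_mono index_max_nonneg)
      then show "norm (f z) \<le> exp (a * (1 + ?I)) * index_max l f m 0"
        using norm_le_index_max[of f z l m] z_eq by simp
    qed
  qed
qed

theorem corollary2: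
  fixes l :: "complex \<Rightarrow> real" and f :: "complex \<Rightarrow> complex"
  assumes "continuous_on UNIV l" and "\<And>z. l z > 0"
    and "l \<in> class_Q \<inter> class_K"
    and "f holomorphic_on UNIV"
    and "bounded_l_index l f"
  shows "(\<lambda>r. ln (max_modulus f r)) \<in> O[at_top](\<lambda>r. min_ray_integral l r)"
proof -
  let ?M = "max_modulus f" and ?I = "min_ray_integral l"
  obtain m where index: "\<And>p z. norm ((deriv ^^ p) f z) / (fact p * l z ^ p) \<le> index_max l f m z"
    using assms(5) unfolding bounded_l_index_def index_max_def by auto
  obtain a where a: "0 < a" and
    upper: "\<And>r. 0 \<le> r \<Longrightarrow> ?M r \<le> exp (a * (1 + ?I r)) * index_max l f m 0"
    using max_modulus_le_exp_min_ray_integral[OF assms(1,2) _ _ assms(4) index] assms(3) by blast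
  obtain b where b: "0 < b" "\<And>r. 1 \<le> r \<Longrightarrow> b \<le> ?I r"
    using min_ray_integral_lower[OF assms(1,2)] by blast
  let ?g = "index_max l f m 0"
  \<comment> \<open>The O-estimate concerns the absolute value, so the logarithm must be bounded
    from below as well.\<close>
  obtain B where B: "0 \<le> B" "\<And>r. 1 \<le> r \<Longrightarrow> \<bar>ln (?M r)\<bar> \<le> B + a * (1 + ?I r)"
  proof (cases "?g = 0")
    case True
    \<comment> \<open>Here the maximum modulus vanishes, and the convention \<open>ln 0 = 0\<close>
      makes the bound hold with \<open>B = 0\<close>.\<close>
    have "?M r = 0" if "1 \<le> r" for r
    proof (rule antisym)
      show "?M r \<le> 0" using upper[of r] that True by simp
      show "0 \<le> ?M r"
        using order_trans[OF norm_ge_zero deriv_le_max_modulus[OF assms(4) that, of 0, simplified]] .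
    qed
    then show ?thesis using a b by (intro that[of 0]) (force intro: mult_nonneg_nonneg)+
  next
    case False
    \<comment> \<open>The index attaining the positive maximum gives a nonzero derivative at 0,
      hence a positive lower bound \<open>d\<close> for \<open>?M r\<close> independent of
      \<open>r \<ge> 1\<close>.\<close>
    have "?g \<in> (\<lambda>s. norm ((deriv ^^ s) f 0) / (fact s * l 0 ^ s)) ` {0..m}"
      unfolding index_max_def by (rule Max_in) auto
    then obtain s where s: "?g = norm ((deriv ^^ s) f 0) / (fact s * l 0 ^ s)" by blast
    define d where "d = norm ((deriv ^^ s) f 0) / fact s"
    have d: "0 < d" using False s by (auto simp: d_def)
    have g: "0 < ?g" using False index_max_nonneg[of l f m 0] by simp
    show ?thesis
    proof (rule that[of "\<bar>ln ?g\<bar> + \<bar>ln d\<bar>"])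
      fix r :: real assume r: "1 \<le> r"
      have dM: "d \<le> ?M r" unfolding d_def by (rule deriv_le_max_modulus[OF assms(4) r])
      then have "ln d \<le> ln (?M r)" using d by simp
      moreover have "ln (?M r) \<le> ln (exp (a * (1 + ?I r)) * ?g)"
        using upper[of r] r dM d g by (intro ln_mono) auto
      moreover have "\<dots> = a * (1 + ?I r) + ln ?g" using g by (simp add: ln_mult)
      moreover have "0 \<le> a * (1 + ?I r)" using a b(1) b(2)[OF r] by simp
      ultimately show "\<bar>ln (?M r)\<bar> \<le> \<bar>ln ?g\<bar> + \<bar>ln d\<bar> + a * (1 + ?I r)" by linarith
    qed simp
  qed
  show ?thesis
  proof (rule bigoI[where c = "(B + a) / b + a"])
    show "\<forall>\<^sub>F r in at_top. norm (ln (?M r)) \<le> ((B + a) / b + a) * norm (?I r)"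
      using eventually_ge_at_top[of 1]
    proof eventually_elim
      case (elim r)
      \<comment> \<open>Since \<open>?I r / b \<ge> 1\<close>, the constant part becomes a multiple
        of \<open>?I r\<close>.\<close>
      have "B + a \<le> (B + a) / b * ?I r"
        using b(1) b(2)[OF elim] B(1) a mult_left_mono[of b "?I r" "B + a"] by (simp add: field_simps)
      then show ?case using B(2)[OF elim] b(1) b(2)[OF elim] by (simp add: algebra_simps)
    qed
  qed
qed

end
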